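(* Let $F:\ell^p\to Y$ be Fréchet differentiable on $\ell^p$ and suppose: (i) there is $L>0$ with $\|F'(x)-F'(z)\|_{\mathcal L(\ell^p,Y)}\le L\|x-z\|$ for all $x,z\in\ell^p$; (ii) there is $c>0$ with $\|F(x)-F(z)-F'(z)(x-z)\|\le c\,D_{f_p}(x,z)$ for all $x,z\in\ell^p$; (iii) there are $s>2$, $0<\varrho<\frac1{sc}$, an $f_p$-minimizing solution $x^\dagger$ and $\omega\in Y$ with $\|\omega\|\le\varrho$ and $J_p(x^\dagger)=F'(x^\dagger)^*\omega$. Then for every starting value $\bar x_0\in\ell^p$ there exists $\alpha_0>\alpha^*$ (large enough) such that $\bar x_0\in\mathcal B_{d_{\alpha_0}}(x_{\alpha_0}^\delta)$, i.e. $D_{f_p}(x_{\alpha_0}^\delta,\bar x_0)\le d_{\alpha_0}$.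
   Context: Fix $1<p\le2$ and $q$ with $\frac1p+\frac1q=1$. $\ell^p=\ell^p(\mathbb N)$ is the real sequence space with dual $\ell^q$ and duality product $\langle\cdot,\cdot\rangle$; $Y$ is a real Hilbert space; all norms are written $\|\cdot\|$. $F:\ell^p\to Y$ is a nonlinear operator that is sequentially closed with respect to the weak topologies of $\ell^p$ and $Y$. Let $y\in\mathrm{Rg}(F)$, $\delta>0$, and fix $y^\delta\in Y$ with $\|y-y^\delta\|\le\delta$. $f_p(x)=\frac1p\|x\|_{\ell^p}^p$; $J_p(x)=\nabla f_p(x)=(|x_i|^{p-1}\mathrm{sgn}(x_i))_{i}\in\ell^q$; Bregman distance $D_{f_p}(z,x)=f_p(z)-f_p(x)-\langle J_p(x),z-x\rangle$. An $f_p$-minimizing solution $x^\dagger$ is an element with $F(x^\dagger)=y$ and $f_p(x^\dagger)=\min\{f_p(x):F(x)=y\}$. For $\alpha>0$: $\Phi_\alpha(x)=\frac12\|F(x)-y^\delta\|^2+\frac{\alpha}{p}\|x\|_{\ell^p}^p$, and $x_\alpha^\delta$ denotes a global minimizer of $\Phi_\alpha$ over $\ell^p$. With the constants of the claim: $\alpha^*:=\frac{\delta}{(s-2)\varrho}$, $A:=\left(\frac{p}{2\alpha^*}\right)^{1/p}\|F(0)-y^\delta\|^{2/p}$, $K:=LA+\|F'(0)\|$, $\gamma:=\frac{1-sc\varrho}{2}$, and for $\alpha\ge\alpha^*$, $r_\alpha:=\frac{2}{1+\sqrt2}\min\left\{\frac{\gamma\alpha}{3cK},\sqrt{\frac{\gamma\alpha}{10cL}}\right\}$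 (with $\gamma\alpha/(3cK)$ read as $+\infty$ if $K=0$). Notation: $B_r(x)=\{z\in\ell^p:\|z-x\|\le r\}$ and $\mathcal B_d(z)=\{x\in\ell^p:D_{f_p}(z,x)\le d\}$. Fix a function $\alpha\mapsto d_\alpha>0$ on $[\alpha^*,\infty)$ that is continuous, strictly increasing, satisfies $d_\alpha\to\infty$ as $\alpha\to\infty$, and $\mathcal B_{d_\alpha}(x_\alpha^\delta)\subset B_{r_\alpha}(x_\alpha^\delta)$ for all $\alpha\ge\alpha^*$ (such a function exists). *)

theory Defs
  imports "HOL-Analysis.Analysis" "HOL-Library.Function_Algebras"
begin

(* The exponent p is a real variable, so l^p is a carrier set in "nat => real" rather than a type;
   the vector space operations are the pointwise ones (0, +, - on functions from Function_Algebras). *)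

definition lp :: "real \<Rightarrow> (nat \<Rightarrow> real) set" where
  "lp p = {x. summable (\<lambda>i. \<bar>x i\<bar> powr p)}"

definition lp_norm :: "real \<Rightarrow> (nat \<Rightarrow> real) \<Rightarrow> real" where
  "lp_norm p x = (\<Sum>i. \<bar>x i\<bar> powr p) powr (1 / p)"

definition pairing :: "(nat \<Rightarrow> real) \<Rightarrow> (nat \<Rightarrow> real) \<Rightarrow> real" where
  "pairing \<xi> x = (\<Sum>i. \<xi> i * x i)"


(* With 1/p + 1/q = 1 the dual of l^p is l^q, acting through the pairing. *)
definition lp_weakly_tendsto ::
    "real \<Rightarrow> real \<Rightarrow> (nat \<Rightarrow> nat \<Rightarrow> real) \<Rightarrow> (nat \<Rightarrow> real) \<Rightarrow> bool" where
  "lp_weakly_tendsto p q u x \<longleftrightarrow>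
     (\<forall>n. u n \<in> lp p) \<and> x \<in> lp p \<and>
     (\<forall>\<xi>\<in>lp q. (\<lambda>n. pairing \<xi> (u n)) \<longlonglongrightarrow> pairing \<xi> x)"

definition weakly_tendsto :: "(nat \<Rightarrow> 'y::real_normed_vector) \<Rightarrow> 'y \<Rightarrow> bool" where
  "weakly_tendsto v w \<longleftrightarrow>
     (\<forall>\<phi>::'y \<Rightarrow> real. bounded_linear \<phi> \<longrightarrow> (\<lambda>n. \<phi> (v n)) \<longlonglongrightarrow> \<phi> w)"

definition weakly_seq_closed ::
    "real \<Rightarrow> real \<Rightarrow> ((nat \<Rightarrow> real) \<Rightarrow> 'y::real_normed_vector) \<Rightarrow> bool" where
  "weakly_seq_closed p q F \<longleftrightarrow>
     (\<forall>u x w. lp_weakly_tendsto p q u x \<and> weakly_tendsto (\<lambda>n. F (u n)) w \<longrightarrow> F x = w)"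


definition lp_bounded_linear ::
    "real \<Rightarrow> ((nat \<Rightarrow> real) \<Rightarrow> 'y::real_normed_vector) \<Rightarrow> bool" where
  "lp_bounded_linear p T \<longleftrightarrow>
     (\<forall>h\<in>lp p. \<forall>k\<in>lp p. T (h + k) = T h + T k) \<and>
     (\<forall>a. \<forall>h\<in>lp p. T (\<lambda>i. a * h i) = a *\<^sub>R T h) \<and>
     (\<exists>B. \<forall>h\<in>lp p. norm (T h) \<le> B * lp_norm p h)"

definition lp_onorm :: "real \<Rightarrow> ((nat \<Rightarrow> real) \<Rightarrow> 'y::real_normed_vector) \<Rightarrow> real" where
  "lp_onorm p T = (SUP h\<in>{h \<in> lp p. lp_norm p h \<le> 1}. norm (T h))"

(* T is the Frechet derivative of F at x; T is determined on lp p only. *)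
definition lp_has_derivative ::
    "real \<Rightarrow> ((nat \<Rightarrow> real) \<Rightarrow> 'y::real_normed_vector) \<Rightarrow> ((nat \<Rightarrow> real) \<Rightarrow> 'y) \<Rightarrow> (nat \<Rightarrow> real) \<Rightarrow> bool"
  where
  "lp_has_derivative p F T x \<longleftrightarrow>
     lp_bounded_linear p T \<and>
     (\<forall>\<epsilon>>0. \<exists>\<eta>>0. \<forall>h\<in>lp p. lp_norm p h < \<eta> \<longrightarrow>
        norm (F (x + h) - F x - T h) \<le> \<epsilon> * lp_norm p h)"

(* The Banach space adjoint T* : Y -> l^q, with Y identified with its dual.  For bounded linear T
   the element is well defined, see lp_adjoint below. *)
definition lp_adjoint ::
    "real \<Rightarrow> real \<Rightarrow> ((nat \<Rightarrow> real) \<Rightarrow> 'y::real_inner) \<Rightarrow> 'y \<Rightarrow> (nat \<Rightarrow> real)" where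
  "lp_adjoint p q T w = (THE \<xi>. \<xi> \<in> lp q \<and> (\<forall>h\<in>lp p. pairing \<xi> h = w \<bullet> T h))"


definition f_p :: "real \<Rightarrow> (nat \<Rightarrow> real) \<Rightarrow> real" where
  "f_p p x = 1 / p * lp_norm p x powr p"

definition J_p :: "real \<Rightarrow> (nat \<Rightarrow> real) \<Rightarrow> (nat \<Rightarrow> real)" where
  "J_p p x = (\<lambda>i. \<bar>x i\<bar> powr (p - 1) * sgn (x i))"

definition bregman :: "real \<Rightarrow> (nat \<Rightarrow> real) \<Rightarrow> (nat \<Rightarrow> real) \<Rightarrow> real" where
  "bregman p z x = f_p p z - f_p p x - pairing (J_p p x) (z - x)"

definition lp_ball :: "real \<Rightarrow> (nat \<Rightarrow> real) \<Rightarrow> real \<Rightarrow> (nat \<Rightarrow> real) set" where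
  "lp_ball p x r = {z \<in> lp p. lp_norm p (z - x) \<le> r}"

(* The centre is the first argument of the Bregman distance. *)
definition bregman_ball :: "real \<Rightarrow> (nat \<Rightarrow> real) \<Rightarrow> real \<Rightarrow> (nat \<Rightarrow> real) set" where
  "bregman_ball p z d = {x \<in> lp p. bregman p z x \<le> d}"


definition f_p_minimizing_solution ::
    "real \<Rightarrow> ((nat \<Rightarrow> real) \<Rightarrow> 'y) \<Rightarrow> 'y \<Rightarrow> (nat \<Rightarrow> real) \<Rightarrow> bool" where
  "f_p_minimizing_solution p F y x \<longleftrightarrow>
     x \<in> lp p \<and> F x = y \<and> (\<forall>z\<in>lp p. F z = y \<longrightarrow> f_p p x \<le> f_p p z)"

definition tikhonov ::
    "real \<Rightarrow> ((nat \<Rightarrow> real) \<Rightarrow> 'y::real_normed_vector) \<Rightarrow> 'y \<Rightarrow> real \<Rightarrow> (nat \<Rightarrow> real) \<Rightarrow> real" where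
  "tikhonov p F yd \<alpha> x = 1 / 2 * (norm (F x - yd))\<^sup>2 + \<alpha> / p * lp_norm p x powr p"

definition tikhonov_minimizer ::
    "real \<Rightarrow> ((nat \<Rightarrow> real) \<Rightarrow> 'y::real_normed_vector) \<Rightarrow> 'y \<Rightarrow> real \<Rightarrow> (nat \<Rightarrow> real) \<Rightarrow> bool" where
  "tikhonov_minimizer p F yd \<alpha> x \<longleftrightarrow>
     x \<in> lp p \<and> (\<forall>z\<in>lp p. tikhonov p F yd \<alpha> x \<le> tikhonov p F yd \<alpha> z)"

definition alpha_star :: "real \<Rightarrow> real \<Rightarrow> real \<Rightarrow> real" where
  "alpha_star \<delta> s \<rho> = \<delta> / ((s - 2) * \<rho>)"

(* The argument a is meant to be alpha_star, and F' the Frechet derivative of F. *)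
definition const_A ::
    "real \<Rightarrow> real \<Rightarrow> ((nat \<Rightarrow> real) \<Rightarrow> 'y::real_normed_vector) \<Rightarrow> 'y \<Rightarrow> real" where
  "const_A p a F yd = (p / (2 * a)) powr (1 / p) * norm (F 0 - yd) powr (2 / p)"

definition const_K ::
    "real \<Rightarrow> real \<Rightarrow> real \<Rightarrow> ((nat \<Rightarrow> real) \<Rightarrow> 'y::real_normed_vector) \<Rightarrow>
     ((nat \<Rightarrow> real) \<Rightarrow> (nat \<Rightarrow> real) \<Rightarrow> 'y) \<Rightarrow> 'y \<Rightarrow> real" where
  "const_K p a L F F' yd = L * const_A p a F yd + lp_onorm p (F' 0)"

definition const_gamma :: "real \<Rightarrow> real \<Rightarrow> real \<Rightarrow> real" where
  "const_gamma s c \<rho> = (1 - s * c * \<rho>) / 2"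

(* For K = 0 the first entry of the minimum is read as +infinity. *)
definition radius :: "real \<Rightarrow> real \<Rightarrow> real \<Rightarrow> real \<Rightarrow> real \<Rightarrow> real" where
  "radius \<gamma> c K L \<alpha> =
     2 / (1 + sqrt 2) *
     (if K = 0 then sqrt (\<gamma> * \<alpha> / (10 * c * L))
      else min (\<gamma> * \<alpha> / (3 * c * K)) (sqrt (\<gamma> * \<alpha> / (10 * c * L))))"


lemma finite_support_lp: "h \<in> lp p" if "\<And>i. i \<ge> n \<Longrightarrow> h i = (0::real)"
proof -
  have "summable (\<lambda>i. \<bar>h i\<bar> powr p)"
    by (rule summable_finite[of "{..<n}"]) (use that in auto)
  then show ?thesis by (simp add: lp_def)
qed

lemma lp_adjoint:
  fixes T :: "(nat \<Rightarrow> real) \<Rightarrow> 'y::real_inner"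
  assumes p: "1 < p" and pq: "1 / p + 1 / q = 1" and T: "lp_bounded_linear p T"
  shows "lp_adjoint p q T w \<in> lp q"
    and "\<forall>h\<in>lp p. pairing (lp_adjoint p q T w) h = w \<bullet> T h"
proof -
  define e where "e = (\<lambda>(i::nat) (j::nat). if j = i then 1 else (0::real))"
  define \<xi> where "\<xi> = (\<lambda>i. w \<bullet> T (e i))"
  define tr where "tr = (\<lambda>(n::nat) h (i::nat). if i < n then h i else (0::real))"
  have e_lp: "e i \<in> lp p" for i
    by (rule finite_support_lp[of "Suc i"]) (auto simp: e_def)
  have tr_lp: "tr n h \<in> lp p" for n h
    by (rule finite_support_lp[of n]) (auto simp: tr_def)
  have add: "T (h + k) = T h + T k" if "h \<in> lp p" "k \<in> lp p" for h k
    using T that by (simp add: lp_bounded_linear_def)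
  have scale: "T (\<lambda>i. a * h i) = a *\<^sub>R T h" if "h \<in> lp p" for a h
    using T that by (simp add: lp_bounded_linear_def)
  obtain B where "\<forall>h\<in>lp p. norm (T h) \<le> B * lp_norm p h"
    using T unfolding lp_bounded_linear_def by blast
  then have B: "norm (T h) \<le> B * lp_norm p h" if "h \<in> lp p" for h
    using that by blast
  have T_tr: "w \<bullet> T (tr n h) = (\<Sum>i<n. \<xi> i * h i)" for n h
  proof (induction n)
    case 0
    have "T (tr 0 h) = 0"
      using scale[OF tr_lp[of 0 h], of 0] by (simp add: tr_def)
    then show ?case by simp
  next
    case (Suc n)
    have eq: "tr (Suc n) h = tr n h + (\<lambda>i. h n * e n i)"
      by (auto simp: tr_def e_def fun_eq_iff less_Suc_eq)
    have "(\<lambda>i. h n * e n i) \<in> lp p"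
      by (rule finite_support_lp[of "Suc n"]) (auto simp: e_def)
    then have "T (tr (Suc n) h) = T (tr n h) + h n *\<^sub>R T (e n)"
      unfolding eq by (simp only: add tr_lp scale e_lp)
    then show ?case
      by (simp add: inner_add_right Suc \<xi>_def mult.commute)
  qed
  have q: "1 < q"
  proof -
    have "1 / q > 0" using p pq by (smt (verit) divide_less_eq_1_pos)
    then have q0: "q > 0" by simp
    have "1 / q < 1" using p pq by (smt (verit) divide_pos_pos)
    then show ?thesis using q0 by simp
  qed
  have qp: "(q - 1) * p = q"
    using pq p q by (simp add: field_simps)
  define C where "C = norm w * \<bar>B\<bar>"
  have C0: "C \<ge> 0" by (simp add: C_def)
  have bound: "(\<Sum>i<n. \<bar>\<xi> i\<bar> powr q) \<le> C powr q" for n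
  proof -
    define S where "S = (\<Sum>i<n. \<bar>\<xi> i\<bar> powr q)"
    define h where "h = (\<lambda>i. \<bar>\<xi> i\<bar> powr (q - 1) * sgn (\<xi> i))"
    have S0: "S \<ge> 0" by (simp add: S_def sum_nonneg)
    have pt: "\<xi> i * h i = \<bar>\<xi> i\<bar> powr q" for i
    proof (cases "\<xi> i = 0")
      case False
      have "\<xi> i * h i = \<bar>\<xi> i\<bar> powr (q - 1) * \<bar>\<xi> i\<bar>"
        by (simp add: h_def abs_sgn)
      also have "\<dots> = \<bar>\<xi> i\<bar> powr (q - 1) * \<bar>\<xi> i\<bar> powr 1"
        using False by simp
      also have "\<dots> = \<bar>\<xi> i\<bar> powr q"
        by (simp only: powr_add[symmetric]) simp
      finally show ?thesis .
    qed simp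
    have pt2: "\<bar>h i\<bar> powr p = \<bar>\<xi> i\<bar> powr q" for i
      by (cases "\<xi> i = 0") (auto simp: h_def abs_mult powr_powr qp abs_sgn_eq)
    have "(\<Sum>i. \<bar>tr n h i\<bar> powr p) = (\<Sum>i<n. \<bar>tr n h i\<bar> powr p)"
      by (rule suminf_finite) (auto simp: tr_def)
    also have "\<dots> = S"
      by (simp add: S_def tr_def pt2)
    finally have nrm: "lp_norm p (tr n h) = S powr (1 / p)"
      by (simp add: lp_norm_def)
    have "S = w \<bullet> T (tr n h)"
      by (simp add: T_tr S_def pt)
    also have "\<dots> \<le> norm w * norm (T (tr n h))"
      by (rule norm_cauchy_schwarz)
    also have "\<dots> \<le> norm w * (\<bar>B\<bar> * S powr (1 / p))"
    proof (rule mult_left_mono)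
      have "norm (T (tr n h)) \<le> B * S powr (1 / p)"
        using B[OF tr_lp[of n h]] nrm by simp
      also have "\<dots> \<le> \<bar>B\<bar> * S powr (1 / p)"
        by (rule mult_right_mono) auto
      finally show "norm (T (tr n h)) \<le> \<bar>B\<bar> * S powr (1 / p)" .
    qed simp
    finally have SC: "S \<le> C * S powr (1 / p)" by (simp add: C_def mult.assoc)
    have "S \<le> C powr q"
    proof (cases "S = 0")
      case False
      then have Sp: "S > 0" using S0 by simp
      have "S powr (1 / q) * S powr (1 / p) = S"
        using pq Sp by (simp only: powr_add[symmetric] add.commute[of "1 / q"]) simp
      then have "S powr (1 / q) * S powr (1 / p) \<le> C * S powr (1 / p)" using SC by simp
      then have "S powr (1 / q) \<le> C" using Sp by simp
      then have "(S powr (1 / q)) powr q \<le> C powr q" using q by (intro powr_mono2) auto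
      then show ?thesis using q Sp by (simp add: powr_powr)
    qed simp
    then show ?thesis by (simp add: S_def)
  qed
  have \<xi>_lq: "\<xi> \<in> lp q"
    unfolding lp_def using summableI_nonneg_bounded[of "\<lambda>i. \<bar>\<xi> i\<bar> powr q", OF _ bound] by simp
  have \<xi>_pair: "pairing \<xi> h = w \<bullet> T h" if h: "h \<in> lp p" for h
  proof -
    have sh: "summable (\<lambda>i. \<bar>h i\<bar> powr p)" using h by (simp add: lp_def)
    define k where "k = (\<lambda>n. h - tr n h)"
    have k_pt: "\<bar>k n i\<bar> powr p = (if i < n then 0 else \<bar>h i\<bar> powr p)" for n i
      by (simp add: k_def tr_def)
    have k_sums: "(\<lambda>i. \<bar>k n i\<bar> powr p) sums ((\<Sum>i. \<bar>h i\<bar> powr p) - (\<Sum>i<n. \<bar>h i\<bar> powr p))" for n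
    proof -
      have "(\<lambda>i. if i < n then \<bar>h i\<bar> powr p else 0) sums (\<Sum>i<n. \<bar>h i\<bar> powr p)"
        using sums_If_finite_set[of "{..<n}" "\<lambda>i. \<bar>h i\<bar> powr p"] by simp
      from sums_diff[OF summable_sums[OF sh] this] show ?thesis
        by (rule sums_cong[THEN iffD1, rotated]) (simp add: k_pt)
    qed
    have k_lp: "k n \<in> lp p" for n
      using k_sums by (auto simp: lp_def sums_iff)
    have "(\<lambda>n. \<Sum>i. \<bar>k n i\<bar> powr p) \<longlonglongrightarrow> (\<Sum>i. \<bar>h i\<bar> powr p) - (\<Sum>i. \<bar>h i\<bar> powr p)"
      unfolding sums_unique[OF k_sums, symmetric]
      by (intro tendsto_intros summable_LIMSEQ sh)
    then have lim: "(\<lambda>n. \<Sum>i. \<bar>k n i\<bar> powr p) \<longlonglongrightarrow> 0" by simp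
    have nn: "(\<Sum>i. \<bar>k n i\<bar> powr p) \<ge> 0" for n
      by (rule suminf_nonneg[OF sums_summable[OF k_sums]]) simp
    have "(\<lambda>n. (\<Sum>i. \<bar>k n i\<bar> powr p) powr (1 / p)) \<longlonglongrightarrow> 0 powr (1 / p)"
      using p nn by (intro tendsto_powr'[OF lim tendsto_const]) simp
    then have "(\<lambda>n. B * lp_norm p (k n)) \<longlonglongrightarrow> B * 0"
      by (intro tendsto_mult_left) (simp add: lp_norm_def)
    then have Blim: "(\<lambda>n. B * lp_norm p (k n)) \<longlonglongrightarrow> 0" by simp
    have "\<forall>\<^sub>F n in sequentially. norm (T (k n)) \<le> B * lp_norm p (k n)"
      by (rule always_eventually) (blast intro: B k_lp)
    from Lim_null_comparison[OF this Blim] have "(\<lambda>n. T (k n)) \<longlonglongrightarrow> 0" .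
    then have "(\<lambda>n. w \<bullet> T h - w \<bullet> T (k n)) \<longlonglongrightarrow> w \<bullet> T h - w \<bullet> 0"
      by (intro tendsto_intros)
    moreover have "w \<bullet> T h - w \<bullet> T (k n) = (\<Sum>i<n. \<xi> i * h i)" for n
    proof -
      have "tr n h + k n = h" by (simp add: k_def)
      then have "T h = T (tr n h) + T (k n)"
        using add[OF tr_lp[of n h] k_lp[of n]] by (simp only:)
      then show ?thesis by (simp add: inner_add_right T_tr)
    qed
    ultimately have "(\<lambda>i. \<xi> i * h i) sums (w \<bullet> T h)" by (simp add: sums_def)
    then show ?thesis by (simp add: pairing_def sums_iff)
  qed
  have pair_e: "pairing \<zeta> (e i) = \<zeta> i" for \<zeta> i
    unfolding pairing_def e_def by (subst suminf_finite[of "{i}"]) auto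
  have "\<exists>!\<xi>. \<xi> \<in> lp q \<and> (\<forall>h\<in>lp p. pairing \<xi> h = w \<bullet> T h)"
  proof (rule ex1I[of _ \<xi>])
    show "\<xi> \<in> lp q \<and> (\<forall>h\<in>lp p. pairing \<xi> h = w \<bullet> T h)"
      using \<xi>_lq \<xi>_pair by blast
  next
    fix \<zeta> assume "\<zeta> \<in> lp q \<and> (\<forall>h\<in>lp p. pairing \<zeta> h = w \<bullet> T h)"
    then have "\<zeta> i = \<xi> i" for i
      using \<xi>_pair e_lp pair_e by metis
    then show "\<zeta> = \<xi>" by auto
  qed
  from theI'[OF this] show "lp_adjoint p q T w \<in> lp q"
    and "\<forall>h\<in>lp p. pairing (lp_adjoint p q T w) h = w \<bullet> T h"
    by (auto simp: lp_adjoint_def)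
qed

end

theory Submission
  imports Defs
begin

text \<open>
  Comparing the Tikhonov functional at its minimizer and at \<open>0\<close> bounds the minimizers
  \<open>x\<^sub>\<alpha>\<close> uniformly for \<open>\<alpha> \<ge> 1\<close>, so their Bregman distance to a fixed point stays bounded,
  whereas \<open>d\<^sub>\<alpha>\<close> tends to infinity.
\<close>

text \<open>A crude Young inequality, with constant 1 in front of both terms: both factors only grow
  when \<open>a\<close> and \<open>b\<close> are replaced by their maximum, and the
  \<open>p\<close>-th power of the maximum is one of the two summands.\<close>

lemma powr_minus_1_mult_le:
  fixes a b p :: real
  assumes "1 \<le> p" "0 \<le> a" "0 \<le> b"
  shows "a powr (p - 1) * b \<le> a powr p + b powr p"
proof -
  \<comment> \<open>The case \<open>t = 0\<close> is covered because \<open>0 powr r\<close> is 0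
    for every \<open>r\<close>.\<close>
  have split: "t powr p = t powr (p - 1) * t" if "0 \<le> t" for t
    using that powr_add[of t "p - 1" 1] by simp
  let ?m = "max a b"
  have "a powr (p - 1) * b \<le> ?m powr (p - 1) * ?m"
    using assms by (intro mult_mono powr_mono2) auto
  also have "\<dots> = ?m powr p"
    using assms by (subst split) auto
  also have "\<dots> \<le> a powr p + b powr p"
    by (auto simp: max_def)
  finally show ?thesis .
qed

lemma f_p_eq_suminf:
  assumes "0 < p" "x \<in> lp p"
  shows "f_p p x = (\<Sum>i. \<bar>x i\<bar> powr p) / p"
proof -
  have "0 \<le> (\<Sum>i. \<bar>x i\<bar> powr p)"
    using assms by (intro suminf_nonneg) (auto simp: lp_def)
  then show ?thesis
    using assms by (simp add: f_p_def lp_norm_def powr_powr)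
qed

text \<open>The duality term is estimated in absolute value by
  \<open>2 * p * f_p p x + p * f_p p z\<close>; adding \<open>f_p p z - f_p p x\<close> produces the
  two coefficients. A crude bound is enough, since it only has to be finite and controlled by
  \<open>f_p p z\<close>.\<close>

lemma bregman_le:
  assumes p: "1 \<le> p" and z: "z \<in> lp p" and x: "x \<in> lp p"
  shows "bregman p z x \<le> (1 + p) * f_p p z + (2 * p - 1) * f_p p x"
proof -
  \<comment> \<open>Splitting \<open>z - x\<close>, the \<open>x\<close> part contributes
    \<open>\<bar>x i\<bar> powr p\<close> exactly, and the Young-type bound for the \<open>z\<close>
    part contributes one further copy together with \<open>\<bar>z i\<bar> powr p\<close>.\<close>
  define g where "g = (\<lambda>i. 2 * \<bar>x i\<bar> powr p + \<bar>z i\<bar> powr p)"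
  let ?t = "\<lambda>i. J_p p x i * (z - x) i"
  have sx: "summable (\<lambda>i. \<bar>x i\<bar> powr p)" and sz: "summable (\<lambda>i. \<bar>z i\<bar> powr p)"
    using x z by (auto simp: lp_def)
  have g: "summable g"
    unfolding g_def by (intro summable_add summable_mult sx sz)
  have bound: "\<bar>?t i\<bar> \<le> g i" for i
  proof -
    have "\<bar>J_p p x i\<bar> \<le> \<bar>x i\<bar> powr (p - 1)"
      by (simp add: J_p_def abs_mult abs_sgn_eq)
    then have "\<bar>?t i\<bar> \<le> \<bar>x i\<bar> powr (p - 1) * (\<bar>z i\<bar> + \<bar>x i\<bar>)"
      unfolding abs_mult by (intro mult_mono) auto
    also have "\<dots> \<le> g i"
      using powr_minus_1_mult_le[of p "\<bar>x i\<bar>" "\<bar>z i\<bar>"] powr_add[of "\<bar>x i\<bar>" "p - 1" 1] p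
      by (simp add: g_def algebra_simps)
    finally show ?thesis .
  qed
  have "summable (\<lambda>i. \<bar>?t i\<bar>)"
    by (rule summable_comparison_test'[OF g]) (use bound in auto)
  then have "\<bar>pairing (J_p p x) (z - x)\<bar> \<le> (\<Sum>i. \<bar>?t i\<bar>)"
    unfolding pairing_def by (rule summable_rabs)
  also have "\<dots> \<le> suminf g"
    by (intro suminf_le bound g) fact
  also have "suminf g = 2 * (\<Sum>i. \<bar>x i\<bar> powr p) + (\<Sum>i. \<bar>z i\<bar> powr p)"
    unfolding g_def using sx sz by (simp add: suminf_add[symmetric] suminf_mult summable_mult)
  also have "\<dots> = 2 * (p * f_p p x) + p * f_p p z"
    using p x z by (simp add: f_p_eq_suminf)
  finally show ?thesis
    by (simp add: bregman_def algebra_simps)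
qed

lemma f_p_tikhonov_minimizer_le:
  assumes p: "0 < p" and "0 < \<alpha>" and x: "tikhonov_minimizer p F yd \<alpha> x"
  shows "f_p p x \<le> (norm (F 0 - yd))\<^sup>2 / (2 * \<alpha>)"
proof -
  have "0 \<in> lp p"
    by (simp add: lp_def)
  then have "tikhonov p F yd \<alpha> x \<le> tikhonov p F yd \<alpha> 0"
    using x by (simp add: tikhonov_minimizer_def)
  then have "\<alpha> * f_p p x + (norm (F x - yd))\<^sup>2 / 2 \<le> (norm (F 0 - yd))\<^sup>2 / 2"
    using p by (simp add: tikhonov_def f_p_def lp_norm_def)
  then have "\<alpha> * f_p p x \<le> (norm (F 0 - yd))\<^sup>2 / 2"
    using zero_le_power2[of "norm (F x - yd)"] by linarith
  then show ?thesis
    using \<open>0 < \<alpha>\<close> by (simp add: field_simps)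
qed

theorem proposition3p6:
  fixes p q \<delta> L c s \<rho> :: real
    and F :: "(nat \<Rightarrow> real) \<Rightarrow> 'y::{real_inner, complete_space}"
    and F' :: "(nat \<Rightarrow> real) \<Rightarrow> (nat \<Rightarrow> real) \<Rightarrow> 'y"
    and y yd \<omega> :: 'y
    and xdag :: "nat \<Rightarrow> real"
    and xmin :: "real \<Rightarrow> nat \<Rightarrow> real"
    and d :: "real \<Rightarrow> real"
  assumes p: "1 < p" "p \<le> 2" and pq: "1 / p + 1 / q = 1"
    and closed: "weakly_seq_closed p q F"
    and y: "y \<in> F ` lp p" and \<delta>: "\<delta> > 0" and yd: "norm (y - yd) \<le> \<delta>"
    and diff: "\<forall>x\<in>lp p. lp_has_derivative p F (F' x) x"
    and L: "L > 0"
    and lipschitz: "\<forall>x\<in>lp p. \<forall>z\<in>lp p.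
          lp_onorm p (\<lambda>h. F' x h - F' z h) \<le> L * lp_norm p (x - z)"
    and c: "c > 0"
    and nonlinearity: "\<forall>x\<in>lp p. \<forall>z\<in>lp p.
          norm (F x - F z - F' z (x - z)) \<le> c * bregman p x z"
    and s: "s > 2" and \<rho>: "0 < \<rho>" "\<rho> < 1 / (s * c)"
    and xdag: "f_p_minimizing_solution p F y xdag"
    and \<omega>: "norm \<omega> \<le> \<rho>"
    and source: "J_p p xdag = lp_adjoint p q (F' xdag) \<omega>"
    and xmin: "\<forall>\<alpha>>0. tikhonov_minimizer p F yd \<alpha> (xmin \<alpha>)"
    and d_pos: "\<forall>\<alpha>\<ge>alpha_star \<delta> s \<rho>. d \<alpha> > 0"
    and d_cont: "continuous_on {alpha_star \<delta> s \<rho>..} d"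
    and d_mono: "strict_mono_on {alpha_star \<delta> s \<rho>..} d"
    and d_top: "filterlim d at_top at_top"
    and d_ball: "\<forall>\<alpha>\<ge>alpha_star \<delta> s \<rho>.
          bregman_ball p (xmin \<alpha>) (d \<alpha>) \<subseteq>
          lp_ball p (xmin \<alpha>)
            (radius (const_gamma s c \<rho>) c (const_K p (alpha_star \<delta> s \<rho>) L F F' yd) L \<alpha>)"
  shows "\<forall>x0\<in>lp p. \<exists>\<alpha>0>alpha_star \<delta> s \<rho>. x0 \<in> bregman_ball p (xmin \<alpha>0) (d \<alpha>0)"
proof
  fix x0 assume x0: "x0 \<in> lp p"
  \<comment> \<open>This is the bound of \<open>bregman_le\<close> with
    \<open>f_p p (xmin \<alpha>)\<close> replaced by its estimate at \<open>\<alpha> = 1\<close>, so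
    it does not depend on \<open>\<alpha>\<close>.\<close>
  define M where "M = (1 + p) * ((norm (F 0 - yd))\<^sup>2 / 2) + (2 * p - 1) * f_p p x0"
  \<comment> \<open>The condition \<open>1 \<le> \<alpha>\<close> gives positivity and lets the
    denominator \<open>2 * \<alpha>\<close> be replaced by 2.\<close>
  have "\<forall>\<^sub>F \<alpha> in at_top. M \<le> d \<alpha> \<and> alpha_star \<delta> s \<rho> < \<alpha> \<and> 1 \<le> \<alpha>"
    using d_top by (intro eventually_conj eventually_gt_at_top eventually_ge_at_top)
      (simp add: filterlim_at_top)
  then obtain \<alpha> where \<alpha>: "M \<le> d \<alpha>" "alpha_star \<delta> s \<rho> < \<alpha>" "1 \<le> \<alpha>"
    using eventually_happens'[OF trivial_limit_at_top_linorder] by blast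
  have min: "tikhonov_minimizer p F yd \<alpha> (xmin \<alpha>)"
    using xmin \<alpha> by simp
  have "f_p p (xmin \<alpha>) \<le> (norm (F 0 - yd))\<^sup>2 / (2 * \<alpha>)"
    using p \<alpha> by (intro f_p_tikhonov_minimizer_le[OF _ _ min]) auto
  also have "\<dots> \<le> (norm (F 0 - yd))\<^sup>2 / 2"
    using \<alpha> by (intro divide_left_mono) auto
  finally have "(1 + p) * f_p p (xmin \<alpha>) \<le> (1 + p) * ((norm (F 0 - yd))\<^sup>2 / 2)"
    using p by (intro mult_left_mono) auto
  moreover have "bregman p (xmin \<alpha>) x0 \<le> (1 + p) * f_p p (xmin \<alpha>) + (2 * p - 1) * f_p p x0"
    using p min x0 by (intro bregman_le) (auto simp: tikhonov_minimizer_def)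
  ultimately have "bregman p (xmin \<alpha>) x0 \<le> d \<alpha>"
    using \<alpha> by (simp add: M_def)
  then show "\<exists>\<alpha>0>alpha_star \<delta> s \<rho>. x0 \<in> bregman_ball p (xmin \<alpha>0) (d \<alpha>0)"
    using x0 \<alpha> by (auto simp: bregman_ball_def)
qed

end
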